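(* Let $\mathcal{C}$ be a properly open convex set in $\mathbb{P}^n$. Then $$\lambda_1(\mathcal{C})=\inf_{\mathcal{H}}\lambda_1(\mathcal{H}),$$ where the infimum is taken over all horoballs $\mathcal{H}$ of $\overline{\mathcal{C}}$.
   Context: A properly open convex set of the real projective space $\mathbb{P}^n$ is a nonempty open set which, in some affine chart $\cong\mathbb{R}^n$ (complement of a projective hyperplane), is a bounded open convex set. The following are computed in such a chart and are projectively invariant. Hilbert distance: for distinct $p,q\in\mathcal{C}$, the line through $p,q$ meets $\partial\mathcal{C}$ at $a,b$, in the order $a,p,q,b$, and $d_{\mathcal{C}}(p,q)=\frac12\ln\left(\frac{\|q-a\|}{\|p-a\|}\cdot\frac{\|p-b\|}{\|q-b\|}\right)$. Finsler metric: for $v\ne0$, with $p^\pm$ the intersections of $\partial\mathcal{C}$ with the line through $p$ directed by $v$, $F_{\mathcal{C}}(p,v)=\frac12\|v\|\left(\frac1{\|p-p^-\|}+\frac1{\|p-p^+\|}\right)$, $F_{\mathcal{C}}(p,0)=0$; dual norm $\|\ell\|_{\mathcal{C}}^*=\sup\{|\ell(v)|: F_{\mathcal{C}}(p,v)\le1\}$. Hilbert measure: $\mu_{\mathcal{C}}(A)=\int_A \frac{\omega_n}{\mathrm{Vol}(\{v: F_{\mathcal{C}}(p,v)<1\})}\,d\mathrm{Vol}(p)$, with $\mathrm{Vol}$ Lebesgue measure and $\omega_n$ the volume of the Euclidean unit ball of $\mathbb{R}^n$. $\lambda_1(\mathcal{C})=\inf_f \frac{\int_{\mathcal{C}}(\|df_p\|_{\mathcal{C}}^*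 )^2\,d\mu_{\mathcal{C}}(p)}{\int_{\mathcal{C}}f^2(p)\,d\mu_{\mathcal{C}}(p)}$ over nonzero Lipschitz functions $f$ with compact support in $\mathcal{C}$. For a horoball $\mathcal{H}$, $\lambda_1(\mathcal{H})$ is the infimum of the same quotient (same $\|\cdot\|^*_{\mathcal{C}}$ and $\mu_{\mathcal{C}}$) over nonzero Lipschitz functions with compact support contained in the interior of $\mathcal{H}$. A horoball of $\overline{\mathcal{C}}$ is a set $\mathcal{H}$ such that, for some $x_0\in\mathcal{C}$ and $p\in\partial\mathcal{C}$, the balls $B_{\mathcal{C}}(x,d_{\mathcal{C}}(x,x_0))$, with $x$ in the open segment $(x_0,p)\subset\mathcal{C}$, converge to $\mathcal{H}$ as $x\to p$ for the Hausdorff topology of $\mathbb{P}^n$. *)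

theory Defs
  imports "HOL-Analysis.Analysis"
begin

section \<open>Real projective space\<close>

text \<open>
  Points of \<open>P\<^sup>n\<close>, \<open>n = CARD('n)\<close>, are the lines through the origin of
  \<open>\<real>\<^sup>n \<times> \<real> = \<real>\<^sup>n\<^sup>+\<^sup>1\<close>.
\<close>

typedef ('n::finite) proj = "{span {v} | v :: (real^'n) \<times> real. v \<noteq> 0}"
proof -
  have "(0, 1) \<noteq> (0 :: (real^'n) \<times> real)"
    by (simp add: zero_prod_def)
  then show ?thesis by blast
qed

definition proj_of :: "(real^'n::finite) \<times> real \<Rightarrow> 'n proj" where
  "proj_of v = Abs_proj (span {v})"

definition unit_reps :: "'n::finite proj \<Rightarrow> ((real^'n) \<times> real) set" where
  "unit_reps P = Rep_proj P \<inter> sphere 0 1"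

lemma unit_reps_eq: obtains u where "norm u = 1" "unit_reps P = {u, -u}" "Rep_proj P = span {u}"
proof -
  obtain v where v: "v \<noteq> 0" "Rep_proj P = span {v}"
    using Rep_proj[of P] by auto
  define u where "u = v /\<^sub>R norm v"
  have u: "norm u = 1" "v = norm v *\<^sub>R u" using v by (auto simp: u_def)
  have "span {v} = span {u}"
  proof (intro antisym span_minimal)
    have "norm v *\<^sub>R u \<in> span {u}" by (intro span_scale span_base) simp
    then show "{v} \<subseteq> span {u}" using u(2) by simp
    have "v /\<^sub>R norm v \<in> span {v}" by (intro span_scale span_base) simp
    then show "{u} \<subseteq> span {v}" by (simp add: u_def)
  qed auto
  then have R: "Rep_proj P = span {u}" using v by simp
  have "unit_reps P = {u, -u}"
  proof (intro set_eqI iffI)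
    fix x assume "x \<in> unit_reps P"
    then have "x \<in> range (\<lambda>c. c *\<^sub>R u)" and nx: "norm x = 1"
      by (simp_all only: unit_reps_def R span_singleton) simp_all
    then obtain c where c: "x = c *\<^sub>R u" by blast
    then have "\<bar>c\<bar> = 1" using u nx by simp
    then have "c = 1 \<or> c = -1" by linarith
    then show "x \<in> {u, -u}" using c by auto
  next
    fix x assume "x \<in> {u, -u}"
    then show "x \<in> unit_reps P"
      using u by (auto simp: unit_reps_def R span_base span_neg)
  qed
  with u R show ?thesis using that by blast
qed

text \<open>
  The metric is the distance between the unit representatives; it induces the usual
  (quotient) topology of \<open>P\<^sup>n\<close>.
\<close>

instantiation proj :: (finite) metric_space
begin

definition dist_proj :: "'a proj \<Rightarrow> 'a proj \<Rightarrow> real" where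
  "dist_proj P Q = setdist (unit_reps P) (unit_reps Q)"

definition uniformity_proj :: "('a proj \<times> 'a proj) filter" where
  "uniformity_proj = (INF e\<in>{0<..}. principal {(x, y). dist x y < e})"

definition open_proj :: "'a proj set \<Rightarrow> bool" where
  "open_proj U \<longleftrightarrow> (\<forall>x\<in>U. eventually (\<lambda>(x', y). x' = x \<longrightarrow> y \<in> U) uniformity)"

instance
proof
  have m: "setdist {u, -u} {v, -v} = min (norm (u - v)) (norm (u + v))" for u v :: "(real^'a) \<times> real"
  proof -
    have 1: "norm (- u - v) = norm (u + v)"
      using norm_minus_cancel[of "u + v"] by simp
    have 2: "norm (- u + v) = norm (u - v)"
      by (simp add: norm_minus_commute)
    have E: "{dist x y |x y. x \<in> {u, -u} \<and> y \<in> {v, -v}} = {norm (u - v), norm (u + v)}"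
    proof -
      have "{dist x y |x y. x \<in> {u, -u} \<and> y \<in> {v, -v}} = {dist u v, dist u (-v), dist (-u) v, dist (-u) (-v)}"
        by blast
      also have "\<dots> = {norm (u - v), norm (u + v)}"
        using 1 2 by (simp add: dist_norm insert_commute)
      finally show ?thesis .
    qed
    have "setdist {u, -u} {v, -v} = Inf {dist x y |x y. x \<in> {u, -u} \<and> y \<in> {v, -v}}"
      by (simp add: setdist_def)
    also have "\<dots> = min (norm (u - v)) (norm (u + v))"
      unfolding E by (simp add: cInf_eq_Min)
    finally show ?thesis .
  qed
  show "dist P Q = 0 \<longleftrightarrow> P = Q" for P Q :: "'a proj"
  proof -
    obtain u where u: "norm u = 1" "unit_reps P = {u, -u}" "Rep_proj P = span {u}"
      by (rule unit_reps_eq)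
    obtain v where v: "norm v = 1" "unit_reps Q = {v, -v}" "Rep_proj Q = span {v}"
      by (rule unit_reps_eq)
    have "dist P Q = 0 \<longleftrightarrow> u = v \<or> u = -v"
    proof -
      have "min a b = 0 \<longleftrightarrow> a = 0 \<or> b = 0" if "a \<ge> 0" "b \<ge> 0" for a b :: real
        using that by linarith
      then show ?thesis
        unfolding dist_proj_def u v m by (simp add: eq_neg_iff_add_eq_0)
    qed
    moreover have "P = Q" if "u = v \<or> u = -v"
    proof -
      have "span {-v} = span {v}"
      proof (intro antisym span_minimal)
        show "{-v} \<subseteq> span {v}" by (simp add: span_base span_neg)
        have "- (- v) \<in> span {-v}" by (intro span_neg span_base) simp
        then show "{v} \<subseteq> span {-v}" by simp
      qed auto
      with that u v have "Rep_proj P = Rep_proj Q" by auto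
      then show ?thesis by (simp add: Rep_proj_inject)
    qed
    moreover have "u = v \<or> u = -v" if "P = Q"
    proof -
      have "u \<in> {v, -v}" using that u(2) v(2) by blast
      then show ?thesis by blast
    qed
    ultimately show ?thesis by blast
  qed
  show "dist P Q \<le> dist P R + dist Q R" for P Q R :: "'a proj"
  proof -
    obtain u where u: "unit_reps P = {u, -u}" by (rule unit_reps_eq)
    obtain v where v: "unit_reps Q = {v, -v}" by (rule unit_reps_eq)
    obtain w where w: "unit_reps R = {w, -w}" by (rule unit_reps_eq)
    have "norm (u - v) \<le> norm (u - w) + norm (v - w)"
      using norm_triangle_ineq4[of "u - w" "v - w"] by simp
    moreover have "norm (u - v) \<le> norm (u + w) + norm (v + w)"
      using norm_triangle_ineq4[of "u + w" "v + w"] by simp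
    moreover have "norm (u + v) \<le> norm (u - w) + norm (v + w)"
      using norm_triangle_ineq[of "u - w" "v + w"] by simp
    moreover have "norm (u + v) \<le> norm (u + w) + norm (v - w)"
      using norm_triangle_ineq[of "u + w" "v - w"] by simp
    ultimately show ?thesis
      unfolding dist_proj_def u v w m by (auto simp: min_def)
  qed
qed (simp_all add: uniformity_proj_def open_proj_def)

end

text \<open>
  Parametrizations of the complements of hyperplanes by \<open>\<real>\<^sup>n\<close>: those that are inverse to an
  affine chart. The complement of the hyperplane \<open>g (\<real>\<^sup>n \<times> {0})\<close> is the range of
  \<open>x \<mapsto> [g (x, 1)]\<close>.
\<close>

definition affine_param :: "(real^'n::finite \<Rightarrow> 'n proj) \<Rightarrow> bool" where
  "affine_param \<phi> \<longleftrightarrow> (\<exists>g :: (real^'n) \<times> real \<Rightarrow> (real^'n) \<times> real. linear g \<and> bij g \<and> \<phi> = (\<lambda>x. proj_of (g (x, 1))))"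

definition bounded_convex_chart :: "(real^'n::finite \<Rightarrow> 'n proj) \<Rightarrow> 'n proj set \<Rightarrow> bool" where
  "bounded_convex_chart \<phi> C \<longleftrightarrow>
     affine_param \<phi> \<and> C \<subseteq> range \<phi> \<and> bounded (\<phi> -` C) \<and> open (\<phi> -` C) \<and> convex (\<phi> -` C)"

definition properly_open_convex :: "'n::finite proj set \<Rightarrow> bool" where
  "properly_open_convex C \<longleftrightarrow> C \<noteq> {} \<and> open C \<and> (\<exists>\<phi>. bounded_convex_chart \<phi> C)"

definition hausdorff_tendsto :: "('b \<Rightarrow> 'a::metric_space set) \<Rightarrow> 'a set \<Rightarrow> 'b filter \<Rightarrow> bool" where
  "hausdorff_tendsto A H F \<longleftrightarrow>
     (\<forall>e>0. \<forall>\<^sub>F x in F. A x \<subseteq> (\<Union>h\<in>H. ball h e) \<and> H \<subseteq> (\<Union>a\<in>A x. ball a e))"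


section \<open>Hilbert geometry of a bounded open convex subset of \<open>\<real>\<^sup>n\<close>\<close>

definition exit_point :: "(real^'n::finite) set \<Rightarrow> real^'n \<Rightarrow> real^'n \<Rightarrow> real^'n" where
  "exit_point \<Omega> p v = (THE y. y \<in> frontier \<Omega> \<and> (\<exists>t>0. y = p + t *\<^sub>R v))"

definition hilbert_dist :: "(real^'n::finite) set \<Rightarrow> real^'n \<Rightarrow> real^'n \<Rightarrow> real" where
  "hilbert_dist \<Omega> p q =
     (if p = q then 0
      else let a = exit_point \<Omega> p (p - q); b = exit_point \<Omega> p (q - p)
           in 1/2 * ln ((norm (q - a) / norm (p - a)) * (norm (p - b) / norm (q - b))))"

text \<open>Balls are taken closed, as the Hausdorff topology concerns closed sets.\<close>

definition hilbert_cball :: "(real^'n::finite) set \<Rightarrow> real^'n \<Rightarrow> real \<Rightarrow> (real^'n) set" where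
  "hilbert_cball \<Omega> x r = {y \<in> \<Omega>. hilbert_dist \<Omega> x y \<le> r}"

definition finsler :: "(real^'n::finite) set \<Rightarrow> real^'n \<Rightarrow> real^'n \<Rightarrow> real" where
  "finsler \<Omega> p v =
     (if v = 0 then 0
      else 1/2 * norm v * (1 / norm (p - exit_point \<Omega> p (- v)) + 1 / norm (p - exit_point \<Omega> p v)))"

definition dual_norm :: "(real^'n::finite) set \<Rightarrow> real^'n \<Rightarrow> (real^'n \<Rightarrow> real) \<Rightarrow> real" where
  "dual_norm \<Omega> p l = (SUP v\<in>{v. finsler \<Omega> p v \<le> 1}. \<bar>l v\<bar>)"

definition hilbert_measure :: "(real^'n::finite) set \<Rightarrow> (real^'n) measure" where
  "hilbert_measure \<Omega> =
     density (lebesgue_on \<Omega>)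
       (\<lambda>p. ennreal (measure lebesgue (ball (0::real^'n) 1) / measure lebesgue {v. finsler \<Omega> p v < 1}))"

text \<open>
  Functions are extended by zero outside \<open>\<Omega>\<close>. Lipschitz functions with compact support are
  differentiable almost everywhere, so the value at the other points is irrelevant.
\<close>

definition diff_norm :: "(real^'n::finite) set \<Rightarrow> (real^'n \<Rightarrow> real) \<Rightarrow> real^'n \<Rightarrow> real" where
  "diff_norm \<Omega> f p =
     (if f differentiable (at p) then dual_norm \<Omega> p (frechet_derivative f (at p)) else 0)"

definition test_function :: "(real^'n::finite) set \<Rightarrow> (real^'n) set \<Rightarrow> (real^'n \<Rightarrow> real) \<Rightarrow> bool" where
  "test_function \<Omega> U f \<longleftrightarrow>
     (\<exists>x. f x \<noteq> 0) \<and>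
     (\<exists>L. \<forall>x\<in>\<Omega>. \<forall>y\<in>\<Omega>. \<bar>f x - f y\<bar> \<le> L * hilbert_dist \<Omega> x y) \<and>
     compact (closure {x. f x \<noteq> 0}) \<and> closure {x. f x \<noteq> 0} \<subseteq> U"

text \<open>
  The quotient takes values in \<open>[0, \<infinity>]\<close>; for a test function the denominator is positive and finite.
\<close>

definition rayleigh :: "(real^'n::finite) set \<Rightarrow> (real^'n \<Rightarrow> real) \<Rightarrow> ennreal" where
  "rayleigh \<Omega> f =
     (\<integral>\<^sup>+p. ennreal ((diff_norm \<Omega> f p)\<^sup>2) \<partial>hilbert_measure \<Omega>) /
     (\<integral>\<^sup>+p. ennreal ((f p)\<^sup>2) \<partial>hilbert_measure \<Omega>)"

definition lambda1_on :: "(real^'n::finite) set \<Rightarrow> (real^'n) set \<Rightarrow> ennreal" where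
  "lambda1_on \<Omega> U = (INF f\<in>{f. test_function \<Omega> U f}. rayleigh \<Omega> f)"


section \<open>Hilbert geometry of a properly open convex set, computed in a chart\<close>

text \<open>
  The notions below depend on \<open>\<phi>\<close> only through projectively invariant quantities.
\<close>

definition lambda1 :: "(real^'n::finite \<Rightarrow> 'n proj) \<Rightarrow> 'n proj set \<Rightarrow> ennreal" where
  "lambda1 \<phi> C = lambda1_on (\<phi> -` C) (\<phi> -` C)"

definition lambda1_horoball :: "(real^'n::finite \<Rightarrow> 'n proj) \<Rightarrow> 'n proj set \<Rightarrow> 'n proj set \<Rightarrow> ennreal" where
  "lambda1_horoball \<phi> C H = lambda1_on (\<phi> -` C) (\<phi> -` interior H)"

text \<open>
  As \<open>C\<close> is relatively compact in the chart, its frontier in \<open>P\<^sup>n\<close> is the image under \<open>\<phi>\<close> of the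
  frontier of \<open>\<phi> -` C\<close>.
\<close>

definition horoball :: "(real^'n::finite \<Rightarrow> 'n proj) \<Rightarrow> 'n proj set \<Rightarrow> 'n proj set \<Rightarrow> bool" where
  "horoball \<phi> C H \<longleftrightarrow> closed H \<and>
     (\<exists>x0 \<in> \<phi> -` C. \<exists>p \<in> frontier (\<phi> -` C).
        hausdorff_tendsto
          (\<lambda>x. \<phi> ` hilbert_cball (\<phi> -` C) x (hilbert_dist (\<phi> -` C) x x0))
          H (at p within open_segment x0 p))"

end

theory Submission
  imports Defs
begin

text \<open>
  The balls \<open>B(x, d(x, x\<^sub>0))\<close> increase as \<open>x\<close> moves along a chord towards its end \<open>p\<close>, because chords
  are geodesics; hence they always converge, to the closure of their union. If \<open>x\<^sub>0\<close> is chosen near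
  the other end of the chord, this horoball contains a given compact subset of \<open>C\<close> in its
  interior, so every test function of \<open>C\<close> is a test function of some horoball. Conversely,
  the interior of a horoball lies in the interior of the closure of \<open>C\<close>, which is \<open>C\<close>.
\<close>

section \<open>The Funk ratio\<close>

text \<open>The exponential of the Funk distance, the asymmetric half of the Hilbert distance. In
  multiplicative form its triangle inequality reduces to a convex combination; the value 1 on the
  diagonal corresponds to distance 0.\<close>

definition funk :: "(real^'n::finite) set \<Rightarrow> real^'n \<Rightarrow> real^'n \<Rightarrow> real" where
  "funk \<Omega> p q =
     (if p = q then 1
      else norm (p - exit_point \<Omega> p (q - p)) / norm (q - exit_point \<Omega> p (q - p)))"

locale bounded_open_convex =
  fixes \<Omega> :: "(real^'n::finite) set"
  assumes bounded: "bounded \<Omega>" and op: "open \<Omega>" and cvx: "convex \<Omega>"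
begin

text \<open>A point strictly between a point of an open convex set and a point of its closure is
  interior, so \<open>b\<close> cannot precede \<open>z\<close> on the ray. Uniqueness of exit
  points and all upper bounds on \<open>funk\<close> come from this.\<close>

lemma not_frontier_between:
  assumes "p \<in> \<Omega>" "z \<in> closure \<Omega>" "b \<in> frontier \<Omega>" "b = p + s *\<^sub>R v" "z = p + t *\<^sub>R v" "s > 0"
  shows "t \<le> s"
proof (rule ccontr)
  assume "\<not> t \<le> s"
  then have st: "s < t" by simp
  have b: "b \<notin> \<Omega>" using assms(3) op by (simp add: frontier_def interior_open)
  then have "v \<noteq> 0" using assms(1,4) by auto
  then have "p \<noteq> z" using assms(5,6) st by auto
  moreover have "b = (1 - s / t) *\<^sub>R p + (s / t) *\<^sub>R z"
    using assms(4-6) st by (simp add: algebra_simps)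
  ultimately have "b \<in> open_segment p z"
    unfolding in_segment using assms(6) st by (intro conjI exI[of _ "s / t"]) auto
  then have "b \<in> interior \<Omega>"
    using in_interior_closure_convex_segment[OF cvx _ assms(2)] assms(1) op by (auto simp: interior_open)
  then show False using b interior_subset by blast
qed

lemma exit_point_eq:
  assumes "p \<in> \<Omega>" "b \<in> frontier \<Omega>" "b = p + s *\<^sub>R v" "s > 0"
  shows "exit_point \<Omega> p v = b"
  unfolding exit_point_def
proof (rule the_equality)
  show "b \<in> frontier \<Omega> \<and> (\<exists>t>0. b = p + t *\<^sub>R v)" using assms by blast
  fix y assume "y \<in> frontier \<Omega> \<and> (\<exists>t>0. y = p + t *\<^sub>R v)"
  then obtain t where t: "y \<in> frontier \<Omega>" "t > 0" "y = p + t *\<^sub>R v" by blast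
  have "b \<in> closure \<Omega>" "y \<in> closure \<Omega>" using t assms by (auto simp: frontier_def)
  then have "t \<le> s" "s \<le> t"
    using not_frontier_between[OF assms(1) _ assms(2,3) t(3) assms(4)]
      not_frontier_between[OF assms(1) _ t(1,3) assms(3) t(2)] by auto
  then show "y = b" using t assms by simp
qed

lemma exit_exists:
  assumes "p \<in> \<Omega>" "v \<noteq> 0"
  obtains s b where "s > 0" "b \<in> frontier \<Omega>" "b = p + s *\<^sub>R v"
  using ray_to_frontier[OF bounded, of p v] assms op by (metis interior_open)

text \<open>On the ray from \<open>p\<close> with \<open>q\<close> at parameter 1 and
  \<open>b\<close> at parameter \<open>s\<close>, the two norms are \<open>s\<close> and
  \<open>s - 1\<close> times \<open>norm (q - p)\<close>.\<close>

lemma funk_eq: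
  assumes "p \<in> \<Omega>" "q \<in> \<Omega>" "p \<noteq> q" "b \<in> frontier \<Omega>" "b = p + s *\<^sub>R (q - p)" "s > 0"
  shows "funk \<Omega> p q = norm (p - b) / norm (q - b)" "funk \<Omega> p q = s / (s - 1)" "s > 1"
proof -
  show 1: "funk \<Omega> p q = norm (p - b) / norm (q - b)"
    using exit_point_eq[OF assms(1,4,5,6)] assms(3) by (simp add: funk_def)
  have "1 \<le> s"
    using not_frontier_between[OF assms(1) _ assms(4,5), of q 1] assms(2,6) closure_subset by force
  moreover have "s \<noteq> 1" using assms op by (auto simp: frontier_def interior_open)
  ultimately show s: "s > 1" by simp
  have "p - b = (- s) *\<^sub>R (q - p)" "q - b = (1 - s) *\<^sub>R (q - p)"
    using assms(5) by (auto simp: algebra_simps)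
  then have "norm (p - b) = s * norm (q - p)" "norm (q - b) = (s - 1) * norm (q - p)"
    using s by simp_all
  then show "funk \<Omega> p q = s / (s - 1)" using 1 assms(3) by simp
qed

text \<open>Clearing denominators, with the exit point as \<open>z\<close>, replaces a quotient of
  norms by a linear relation that can be scaled and added. On the diagonal the coefficient of
  \<open>z\<close> vanishes, so \<open>z = p\<close> serves.\<close>

lemma funk_repr:
  assumes "p \<in> \<Omega>" "q \<in> \<Omega>"
  obtains z where "z \<in> closure \<Omega>" "funk \<Omega> p q *\<^sub>R q = p + (funk \<Omega> p q - 1) *\<^sub>R z" "funk \<Omega> p q \<ge> 1"
proof (cases "p = q")
  case True
  then show ?thesis using that[of p] assms closure_subset by (auto simp: funk_def)
next
  case False
  then obtain s b where b: "s > 0" "b \<in> frontier \<Omega>" "b = p + s *\<^sub>R (q - p)"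
    using exit_exists[OF assms(1), of "q - p"] by auto
  note f = funk_eq(2,3)[OF assms False b(2,3,1)]
  have r: "funk \<Omega> p q - 1 = 1 / (s - 1)" using f by (simp add: field_simps)
  have "funk \<Omega> p q *\<^sub>R q = p + (funk \<Omega> p q - 1) *\<^sub>R b"
  proof -
    have "(s - 1) *\<^sub>R (funk \<Omega> p q *\<^sub>R q) = (s - 1) *\<^sub>R (p + (funk \<Omega> p q - 1) *\<^sub>R b)"
    proof -
      have "(s - 1) *\<^sub>R (funk \<Omega> p q *\<^sub>R q) = s *\<^sub>R q" using f by simp
      also have "\<dots> = (s - 1) *\<^sub>R p + b" by (simp add: b(3) algebra_simps)
      also have "\<dots> = (s - 1) *\<^sub>R (p + (funk \<Omega> p q - 1) *\<^sub>R b)"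
        using f(2) unfolding r by (simp add: scaleR_add_right)
      finally show ?thesis .
    qed
    then show ?thesis using f by (simp only: scaleR_cancel_left) simp
  qed
  moreover have "funk \<Omega> p q \<ge> 1"
  proof -
    have "1 / (s - 1) \<ge> 0" using f(2) by simp
    then show ?thesis using r by linarith
  qed
  ultimately show ?thesis using that b(2) by (auto simp: frontier_def)
qed

lemma funk_ge_1: "p \<in> \<Omega> \<Longrightarrow> q \<in> \<Omega> \<Longrightarrow> funk \<Omega> p q \<ge> 1"
  using funk_repr by metis

text \<open>Solving for \<open>z\<close> puts it at parameter \<open>l / (l - 1)\<close> on the ray
  from \<open>p\<close> through \<open>q\<close>, hence not beyond the exit parameter
  \<open>s\<close>. As \<open>x / (x - 1)\<close> is decreasing and its own inverse on
  \<open>x > 1\<close>, this bounds \<open>funk\<close> from above.\<close>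

lemma funk_le:
  assumes "p \<in> \<Omega>" "q \<in> \<Omega>" "z \<in> closure \<Omega>" "l *\<^sub>R q = p + (l - 1) *\<^sub>R z" "l \<ge> 1"
  shows "funk \<Omega> p q \<le> l"
proof (cases "p = q")
  case True
  then show ?thesis using assms by (simp add: funk_def)
next
  case False
  then obtain s b where b: "s > 0" "b \<in> frontier \<Omega>" "b = p + s *\<^sub>R (q - p)"
    using exit_exists[OF assms(1), of "q - p"] by auto
  note f = funk_eq(2,3)[OF assms(1,2) False b(2,3,1)]
  have "l \<noteq> 1" using False assms(4) by auto
  then have l: "l > 1" using assms(5) by simp
  have "z = p + (l / (l - 1)) *\<^sub>R (q - p)"
  proof -
    have "(l - 1) *\<^sub>R z = l *\<^sub>R q - p" using assms(4) by simp
    also have "\<dots> = (l - 1) *\<^sub>R (p + (l / (l - 1)) *\<^sub>R (q - p))"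
      using l by (simp add: scaleR_add_right) (simp add: algebra_simps)
    finally show ?thesis using l by simp
  qed
  then have "l / (l - 1) \<le> s"
    using not_frontier_between[OF assms(1,3) b(2,3)] b(1) by blast
  then show ?thesis unfolding f(1) using l f(2) by (simp add: field_simps)
qed

text \<open>\<open>funk \<Omega> p q \<le> l\<close> means \<open>l q - p \<in> (l - 1) closure \<Omega>\<close>; adding \<open>l\<close> times the relation for
  \<open>(q, r)\<close> to the one for \<open>(p, q)\<close> stays in the convex cone.\<close>

lemma funk_triangle:
  assumes "p \<in> \<Omega>" "q \<in> \<Omega>" "r \<in> \<Omega>"
  shows "funk \<Omega> p r \<le> funk \<Omega> p q * funk \<Omega> q r"
proof -
  define l m where "l = funk \<Omega> p q" and "m = funk \<Omega> q r"
  obtain z where z: "z \<in> closure \<Omega>" "l *\<^sub>R q = p + (l - 1) *\<^sub>R z" "l \<ge> 1"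
    using funk_repr[OF assms(1,2)] unfolding l_def by metis
  obtain w where w: "w \<in> closure \<Omega>" "m *\<^sub>R r = q + (m - 1) *\<^sub>R w" "m \<ge> 1"
    using funk_repr[OF assms(2,3)] unfolding m_def by metis
  have lm: "l * m \<ge> 1" using mult_mono[of 1 l 1 m] z(3) w(3) by simp
  have e: "(l * m) *\<^sub>R r = p + ((l - 1) *\<^sub>R z + (l * (m - 1)) *\<^sub>R w)"
  proof -
    have "(l * m) *\<^sub>R r = l *\<^sub>R (m *\<^sub>R r)" by simp
    also have "\<dots> = l *\<^sub>R q + (l * (m - 1)) *\<^sub>R w" unfolding w(2) by (simp add: scaleR_add_right)
    finally show ?thesis using z(2) by simp
  qed
  show ?thesis
  \<comment> \<open>The weights \<open>l - 1\<close> and \<open>l * (m - 1)\<close> add up to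
    \<open>l * m - 1\<close>. If this is zero, the three points coincide; otherwise dividing by it
    gives a convex combination of \<open>z\<close> and \<open>w\<close>.\<close>
  proof (cases "l * m = 1")
    case True
    have "1 * m \<le> l * m" using z(3) w(3) by (intro mult_right_mono) auto
    then have "m \<le> 1" using True by simp
    then have "m = 1" "l = 1" using w True by auto
    then have "p = q" "q = r" using z w by auto
    then show ?thesis by (simp add: funk_def)
  next
    case False
    define u where "u = ((l - 1) / (l * m - 1)) *\<^sub>R z + (l * (m - 1) / (l * m - 1)) *\<^sub>R w"
    have "u \<in> closure \<Omega>"
      unfolding u_def
    proof (rule convexD[OF convex_closure[OF cvx] z(1) w(1)])
      show "(l - 1) / (l * m - 1) + l * (m - 1) / (l * m - 1) = 1"
        using False by (simp add: add_divide_distrib[symmetric] algebra_simps)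
    qed (use z w lm in auto)
    moreover have "(l * m) *\<^sub>R r = p + (l * m - 1) *\<^sub>R u"
      unfolding e u_def scaleR_add_right using False by simp
    ultimately show ?thesis
      using funk_le[OF assms(1,3) _ _ lm] unfolding l_def m_def by blast
  qed
qed

text \<open>The exponential of twice the Hilbert distance.\<close>

definition gap :: "real^'n \<Rightarrow> real^'n \<Rightarrow> real" where
  "gap p q = funk \<Omega> p q * funk \<Omega> q p"

lemma gap_ge_1: "p \<in> \<Omega> \<Longrightarrow> q \<in> \<Omega> \<Longrightarrow> gap p q \<ge> 1"
  unfolding gap_def using mult_mono[of 1 "funk \<Omega> p q" 1 "funk \<Omega> q p"] funk_ge_1[of p q] funk_ge_1[of q p] by simp

lemma gap_triangle:
  assumes "p \<in> \<Omega>" "q \<in> \<Omega>" "r \<in> \<Omega>"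
  shows "gap p r \<le> gap p q * gap q r"
proof -
  have n: "0 \<le> funk \<Omega> x y" if "x \<in> \<Omega>" "y \<in> \<Omega>" for x y
    using funk_ge_1[OF that] by simp
  have "funk \<Omega> p r * funk \<Omega> r p \<le> (funk \<Omega> p q * funk \<Omega> q r) * (funk \<Omega> r q * funk \<Omega> q p)"
    using funk_triangle assms n by (intro mult_mono mult_nonneg_nonneg) auto
  then show ?thesis by (simp add: gap_def mult_ac)
qed

lemma hilbert_dist_eq:
  assumes "p \<in> \<Omega>" "q \<in> \<Omega>"
  shows "hilbert_dist \<Omega> p q = 1/2 * ln (gap p q)"
proof (cases "p = q")
  case True
  then show ?thesis by (simp add: hilbert_dist_def gap_def funk_def)
next
  case False
  then obtain s a where a: "s > 0" "a \<in> frontier \<Omega>" "a = q + s *\<^sub>R (p - q)"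
    using exit_exists[OF assms(2), of "p - q"] by auto
  \<comment> \<open>\<open>s > 1\<close> places \<open>a\<close> beyond \<open>p\<close> as seen
    from \<open>q\<close>, so the rays from \<open>p\<close> and from \<open>q\<close> in direction
    \<open>p - q\<close> leave the set at the same point.\<close>
  have s: "s > 1" using funk_eq(3)[OF assms(2,1) False[symmetric] a(2,3,1)] .
  have "a = p + (s - 1) *\<^sub>R (p - q)" using a(3) by (simp add: algebra_simps)
  then have 1: "exit_point \<Omega> p (p - q) = a" using exit_point_eq[OF assms(1) a(2)] s by simp
  have 2: "exit_point \<Omega> q (p - q) = a" using exit_point_eq[OF assms(2) a(2,3,1)] .
  show ?thesis using False by (simp add: hilbert_dist_def gap_def funk_def Let_def 1 2 mult.commute)
qed

lemma mem_hilbert_cball_iff: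
  assumes "x \<in> \<Omega>" "x0 \<in> \<Omega>"
  shows "y \<in> hilbert_cball \<Omega> x (hilbert_dist \<Omega> x x0) \<longleftrightarrow> y \<in> \<Omega> \<and> gap x y \<le> gap x x0"
proof -
  have "hilbert_dist \<Omega> x y \<le> hilbert_dist \<Omega> x x0 \<longleftrightarrow> gap x y \<le> gap x x0" if "y \<in> \<Omega>"
    using gap_ge_1[OF assms] gap_ge_1[OF assms(1) that] hilbert_dist_eq[OF assms]
      hilbert_dist_eq[OF assms(1) that] ln_le_cancel_iff[of "gap x y" "gap x x0"] by linarith
  then show ?thesis by (auto simp: hilbert_cball_def)
qed


section \<open>Horoballs\<close>

text \<open>The cross ratio of the four points in the chord parameter, with ends at 0 and 1. It
  equals \<open>h s / h t\<close> for \<open>h s = (1 - s) / s\<close>, so it is multiplicative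
  along the chord: this is the geodesic property.\<close>

lemma gap_on_chord:
  assumes "p \<in> frontier \<Omega>" "q \<in> frontier \<Omega>" "x \<in> \<Omega>" "y \<in> \<Omega>" "x \<noteq> y"
    and "x = p + s *\<^sub>R (q - p)" "y = p + t *\<^sub>R (q - p)" "0 < s" "s < t" "t < 1"
  shows "gap x y = (1 - s) / (1 - t) * (t / s)"
proof -
  have "q \<noteq> p" using assms by auto
  have xy: "y - x = (t - s) *\<^sub>R (q - p)" by (simp add: assms(6,7) algebra_simps)
  have q: "q = x + ((1 - s) / (t - s)) *\<^sub>R (y - x)"
  proof -
    have "((1 - s) / (t - s)) *\<^sub>R (y - x) = (1 - s) *\<^sub>R (q - p)" using assms(9) by (simp add: xy)
    then show ?thesis by (simp add: assms(6) algebra_simps)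
  qed
  have p: "p = y + (t / (t - s)) *\<^sub>R (x - y)"
  proof -
    have "x - y = - ((t - s) *\<^sub>R (q - p))" using xy by (metis minus_diff_eq)
    then show ?thesis using assms(9) by (simp add: assms(7))
  qed
  have frac: "a / c / (a / c - 1) = a / (a - c)" if "c \<noteq> 0" for a c :: real
  proof -
    have "a / c - 1 = (a - c) / c" using that by (simp add: diff_divide_distrib)
    then show ?thesis using that by simp
  qed
  have "funk \<Omega> x y = (1 - s) / (t - s) / ((1 - s) / (t - s) - 1)"
    by (rule funk_eq(2)[OF assms(3-5,2) q]) (use assms in simp)
  also have "\<dots> = (1 - s) / (1 - t)" using frac[of "t - s" "1 - s"] assms(9) by simp
  finally have 1: "funk \<Omega> x y = (1 - s) / (1 - t)" .
  have "funk \<Omega> y x = t / (t - s) / (t / (t - s) - 1)"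
    by (rule funk_eq(2)[OF assms(4,3) assms(5)[symmetric] assms(1) p]) (use assms in simp)
  also have "\<dots> = t / s" using frac[of "t - s" t] assms(9) by simp
  finally show ?thesis using 1 by (simp add: gap_def)
qed

lemma chord_mem:
  assumes "p \<in> frontier \<Omega>" "c \<in> \<Omega>" "0 < t" "t \<le> 1"
  shows "p + t *\<^sub>R (c - p) \<in> \<Omega>"
proof -
  have "c \<in> interior \<Omega>" "p \<in> closure \<Omega>" using assms op by (auto simp: interior_open frontier_def)
  then have "p - t *\<^sub>R (p - c) \<in> interior \<Omega>"
    using mem_interior_closure_convex_shrink[OF cvx] assms by blast
  then show ?thesis using op by (simp add: interior_open algebra_simps)
qed

lemma frontier_notin: "p \<in> frontier \<Omega> \<Longrightarrow> p \<notin> \<Omega>"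
  using op by (simp add: frontier_def interior_open)

lemma opposite_exit:
  assumes "p \<in> frontier \<Omega>" "c \<in> \<Omega>"
  obtains q s where "q \<in> frontier \<Omega>" "c = p + s *\<^sub>R (q - p)" "0 < s" "s < 1" "q \<noteq> p"
proof -
  have "c \<noteq> p" using frontier_notin assms by auto
  then obtain t q where t: "t > 0" "q \<in> frontier \<Omega>" "q = c + t *\<^sub>R (c - p)"
    using exit_exists[OF assms(2), of "c - p"] by auto
  have "q - p = (1 + t) *\<^sub>R (c - p)" using t(3) by (simp add: algebra_simps)
  then have "c = p + (1 / (1 + t)) *\<^sub>R (q - p)" "q \<noteq> p" using t(1) \<open>c \<noteq> p\<close> by auto
  then show ?thesis using that[OF t(2)] t(1) by simp
qed

lemma chord_mem':
  assumes "p \<in> frontier \<Omega>" "p + s *\<^sub>R (q - p) \<in> \<Omega>" "0 < t" "t \<le> s"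
  shows "p + t *\<^sub>R (q - p) \<in> \<Omega>"
  using chord_mem[OF assms(1,2), of "t / s"] assms(3,4) by simp

text \<open>Chords are geodesics, so by the triangle inequality the balls increase with \<open>x\<close>.\<close>

lemma hilbert_cball_mono:
  assumes "p \<in> frontier \<Omega>" "x0 \<in> \<Omega>" "0 < s" "s \<le> t" "t < 1"
    and x: "x = p + t *\<^sub>R (x0 - p)" and x': "x' = p + s *\<^sub>R (x0 - p)"
  shows "hilbert_cball \<Omega> x (hilbert_dist \<Omega> x x0) \<subseteq> hilbert_cball \<Omega> x' (hilbert_dist \<Omega> x' x0)"
proof (cases "s = t")
  case True
  then show ?thesis using x x' by simp
next
  case False
  then have st: "s < t" using assms by simp
  \<comment> \<open>The parameters \<open>s\<close> and \<open>t\<close> refer to the segment from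
    \<open>p\<close> to \<open>x0\<close>, while \<open>gap_on_chord\<close> needs the whole chord.
    If \<open>x0\<close> has parameter \<open>r\<close> there, they become \<open>s * r\<close> and
    \<open>t * r\<close>.\<close>
  obtain q r where q: "q \<in> frontier \<Omega>" "x0 = p + r *\<^sub>R (q - p)" "0 < r" "r < 1" "q \<noteq> p"
    using opposite_exit[OF assms(1,2)] .
  have xe: "x = p + (t * r) *\<^sub>R (q - p)" "x' = p + (s * r) *\<^sub>R (q - p)" using x x' q(2) by auto
  have o: "0 < s * r" "s * r < t * r" "t * r < r" using st assms q by auto
  then have o': "0 < t * r" "t * r < 1" "s * r < r" using q(4) by linarith+
  have ne: "x' \<noteq> x" "x \<noteq> x0" "x' \<noteq> x0" using o q(5) by (auto simp: xe q(2))
  have m: "x \<in> \<Omega>" "x' \<in> \<Omega>" using chord_mem[OF assms(1,2)] assms by auto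
  have cancel: "(1 - u) / (1 - v) * (v / u) * ((1 - v) / (1 - r) * (r / v)) = (1 - u) / (1 - r) * (r / u)"
    if "v \<noteq> 0" "v < 1" for u v
    using that by simp
  have "gap x' x * gap x x0 = gap x' x0"
    unfolding gap_on_chord[OF assms(1) q(1) m(2,1) ne(1) xe(2,1) o(1,2) o'(2)]
      gap_on_chord[OF assms(1) q(1) m(1) assms(2) ne(2) xe(1) q(2) o'(1) o(3) q(4)]
      gap_on_chord[OF assms(1) q(1) m(2) assms(2) ne(3) xe(2) q(2) o(1) o'(3) q(4)]
    by (rule cancel) (use o' in auto)
  moreover have "gap x' y \<le> gap x' x * gap x x0" if "y \<in> \<Omega>" "gap x y \<le> gap x x0" for y
    using gap_triangle[OF m(2,1) that(1)] mult_left_mono[OF that(2), of "gap x' x"] gap_ge_1[OF m(2,1)]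
    by linarith
  ultimately show ?thesis by (auto simp: mem_hilbert_cball_iff m assms(2))
qed

text \<open>Prolonging the segment from \<open>x\<close> past \<open>y\<close> by the factor
  \<open>d / D\<close> stays in the ball around \<open>y\<close>; the point so reached is a witness
  for \<open>funk_le\<close> with ratio \<open>1 + D / d\<close>.\<close>

lemma funk_le_of_cball:
  assumes "x \<in> \<Omega>" "y \<in> \<Omega>" "cball y d \<subseteq> closure \<Omega>" "d > 0" "dist x y \<le> D"
  shows "funk \<Omega> x y \<le> 1 + D / d"
proof (cases "x = y")
  case True
  have "0 \<le> D" using assms(5) zero_le_dist[of x y] by linarith
  then show ?thesis using True assms(4) by (simp add: funk_def)
next
  case False
  then have D: "D > 0" using assms(5) zero_less_dist_iff[of x y] by linarith
  have "dist y (y + (d / D) *\<^sub>R (y - x)) = d / D * dist x y"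
    using D assms(4) by (simp add: dist_norm norm_minus_commute)
  also have "\<dots> \<le> d / D * D" using D assms(4,5) by (intro mult_left_mono) auto
  also have "\<dots> = d" using D by simp
  finally have "y + (d / D) *\<^sub>R (y - x) \<in> closure \<Omega>" using assms(3) by auto
  moreover have "(1 + D / d) *\<^sub>R y = x + (1 + D / d - 1) *\<^sub>R (y + (d / D) *\<^sub>R (y - x))"
    using D assms(4) by (simp add: scaleR_add_right scaleR_add_left)
  ultimately show ?thesis
    by (rule funk_le[OF assms(1,2)]) (use D assms(4) in simp)
qed

text \<open>With \<open>x\<^sub>0\<close> close enough to the end \<open>q\<close> of the chord opposite to \<open>p\<close>, the ball around \<open>x\<close>
  through \<open>x\<^sub>0\<close> swallows all points at depth \<open>d\<close>: as \<open>x\<close> moves to \<open>p\<close>, both gaps grow like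
  \<open>1 / norm (x - p)\<close>, while \<open>gap x x\<^sub>0\<close> carries a further factor \<open>1 / norm (x\<^sub>0 - q)\<close>.\<close>

lemma deep_points_in_ball:
  assumes "p \<in> frontier \<Omega>" "c \<in> \<Omega>" "cball c d \<subseteq> \<Omega>" "d > 0"
  obtains x0 x where "x0 \<in> \<Omega>" "x \<in> open_segment x0 p"
    "\<And>y. cball y d \<subseteq> \<Omega> \<Longrightarrow> y \<in> hilbert_cball \<Omega> x (hilbert_dist \<Omega> x x0)"
proof -
  obtain q r where q: "q \<in> frontier \<Omega>" "c = p + r *\<^sub>R (q - p)" "0 < r" "r < 1" "q \<noteq> p"
    using opposite_exit[OF assms(1,2)] .
  define D where "D = diameter \<Omega> + 1"
  have D: "dist x y \<le> D" if "x \<in> \<Omega>" "y \<in> \<Omega>" for x y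
    using diameter_bounded_bound[OF bounded that] by (simp add: D_def)
  have "D > 0" using diameter_ge_0[OF bounded] by (simp add: D_def)
  define M where "M = 1 + D / d"
  have M: "M > 1" using \<open>D > 0\<close> assms(4) by (simp add: M_def)
  \<comment> \<open>Chosen so that \<open>(1 - r) / e = 2 * M ^ 2\<close>, the bound found below for
    \<open>gap x y\<close>. Since \<open>M > 1\<close>, also \<open>e < 1 - r\<close>, so
    \<open>x0\<close> lies between \<open>c\<close> and \<open>q\<close>.\<close>
  define e where "e = (1 - r) / (2 * M ^ 2)"
  have M2: "M ^ 2 > 1" using M by simp
  have e: "e > 0" "e < 1 - r" using q(4) M2 unfolding e_def by (auto simp: divide_simps)
  define x0 where "x0 = p + (1 - e) *\<^sub>R (q - p)"
  \<comment> \<open>The midpoint of \<open>p\<close> and \<open>c\<close>. Halving towards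
    \<open>p\<close> carries the ball of radius \<open>d\<close> around \<open>c\<close> to one of
    radius \<open>d / 2\<close> around \<open>x\<close>, which controls
    \<open>funk \<Omega> y x\<close>.\<close>
  define x where "x = p + (r / 2) *\<^sub>R (q - p)"
  have x: "x \<in> \<Omega>" unfolding x_def by (rule chord_mem'[OF assms(1), of r]) (use assms q in auto)
  have x0: "x0 \<in> \<Omega>"
  proof -
    have "c - q = - ((1 - r) *\<^sub>R (q - p))" by (simp add: q(2) algebra_simps)
    then have "(e / (1 - r)) *\<^sub>R (c - q) = - (e *\<^sub>R (q - p))" using q(4) by simp
    then have "x0 = q + (e / (1 - r)) *\<^sub>R (c - q)" by (simp add: x0_def algebra_simps)
    then show ?thesis using chord_mem[OF q(1) assms(2)] e q(4) by simp
  qed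
  have ne: "x \<noteq> x0"
  proof -
    have "x0 - x = (1 - e - r / 2) *\<^sub>R (q - p)" by (simp add: x_def x0_def algebra_simps)
    then show ?thesis using e q by auto
  qed
  have seg: "x \<in> open_segment x0 p"
  proof -
    have "x = (1 - (1 - r / 2 / (1 - e))) *\<^sub>R x0 + (1 - r / 2 / (1 - e)) *\<^sub>R p"
    proof -
      have "b / a * a = b" if "a \<noteq> 0" for a b :: real using that by simp
      from this[of "1 - e" "r / 2"] have "r / 2 / (1 - e) * (1 - e) = r / 2" using e q(3) by linarith
      moreover have "x0 - p = (1 - e) *\<^sub>R (q - p)" by (simp add: x0_def)
      ultimately have "x = p + (r / 2 / (1 - e)) *\<^sub>R (x0 - p)" by (simp only: x_def scaleR_scaleR)
      then show ?thesis by (simp add: algebra_simps)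
    qed
    moreover have "0 < 1 - r / 2 / (1 - e)" "1 - r / 2 / (1 - e) < 1" using e q(3) by (auto simp: divide_simps)
    moreover have "x0 \<noteq> p" using x0 frontier_notin[OF assms(1)] by auto
    ultimately show ?thesis unfolding in_segment by blast
  qed
  have g: "gap x x0 = (1 - r / 2) / e * ((1 - e) / (r / 2))"
    using gap_on_chord[OF assms(1) q(1) x x0 ne x_def x0_def] e q by simp
  have "gap x y \<le> gap x x0" if y: "cball y d \<subseteq> \<Omega>" for y
  proof -
    have yO: "y \<in> \<Omega>" using y assms(4) by auto
    have "funk \<Omega> x y \<le> M" unfolding M_def
      using funk_le_of_cball[OF x yO _ assms(4) D[OF x yO]] y closure_subset by blast
    moreover have "funk \<Omega> y x \<le> 1 + D / (d / 2)"
    proof (rule funk_le_of_cball[OF yO x _ _ D[OF yO x]])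
      show "cball x (d / 2) \<subseteq> closure \<Omega>"
      proof
        fix w assume w: "w \<in> cball x (d / 2)"
        \<comment> \<open>The image of \<open>w\<close> under doubling from \<open>p\<close>, namely
          \<open>2 w - p\<close>, since \<open>x\<close> is the midpoint of \<open>p\<close> and
          \<open>c\<close>.\<close>
        define w' where "w' = c + 2 *\<^sub>R (w - x)"
        have "w' \<in> cball c d" using w by (simp add: w'_def dist_norm norm_minus_commute)
        then have "w' \<in> closure \<Omega>" using assms(3) closure_subset by blast
        moreover have "p \<in> closure \<Omega>" using assms(1) by (simp add: frontier_def)
        ultimately have "(1/2) *\<^sub>R w' + (1/2) *\<^sub>R p \<in> closure \<Omega>"
          by (intro convexD[OF convex_closure[OF cvx]]) auto
        moreover have "(1/2) *\<^sub>R w' + (1/2) *\<^sub>R p = w"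
        proof -
          have "(1/2) *\<^sub>R w' + (1/2) *\<^sub>R p = (w - x) + (1/2) *\<^sub>R (c + p)"
            by (simp add: w'_def scaleR_add_right)
          also have "(1/2) *\<^sub>R (c + p) = x"
            by (simp add: x_def q(2) scaleR_add_right scaleR_half_double add.assoc[symmetric]
                  flip: scaleR_add_left)
          finally show ?thesis by simp
        qed
        ultimately show "w \<in> closure \<Omega>" by simp
      qed
    qed (use assms(4) in simp)
    then have "funk \<Omega> y x \<le> 2 * M" unfolding M_def by (simp add: mult.commute)
    ultimately have "gap x y \<le> M * (2 * M)"
      unfolding gap_def using funk_ge_1[OF yO x] M by (intro mult_mono) auto
    also have "\<dots> = (1 - r) / e"
      unfolding e_def using M q(4) by (simp add: power2_eq_square)
    \<comment> \<open>Only the factor \<open>1 / e\<close> is essential: \<open>1 - r / 2\<close> is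
      at least \<open>1 - r\<close>, and \<open>e < 1 - r\<close> makes the last factor at least
      1.\<close>
    also have "\<dots> \<le> (1 - r / 2) / e * ((1 - e) / (r / 2))"
    proof -
      have "(1 - r) / e \<le> (1 - r / 2) / e" using e q by (intro divide_right_mono) auto
      also have "\<dots> = (1 - r / 2) / e * 1" by simp
      also have "\<dots> \<le> (1 - r / 2) / e * ((1 - e) / (r / 2))"
        using e q by (intro mult_left_mono) (auto simp: field_simps)
      finally show ?thesis .
    qed
    finally show ?thesis using g by simp
  qed
  then have "y \<in> hilbert_cball \<Omega> x (hilbert_dist \<Omega> x x0)" if "cball y d \<subseteq> \<Omega>" for y
    using that assms(4) by (auto simp: mem_hilbert_cball_iff[OF x x0])
  then show ?thesis using that[OF x0 seg] by blast
qed

text \<open>Every \<open>x\<close> on the segment closer to \<open>p\<close> than \<open>x1\<close>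
  has a ball containing that of \<open>x1\<close>, by \<open>hilbert_cball_mono\<close>.\<close>

lemma eventually_mem_hilbert_cball:
  assumes "p \<in> frontier \<Omega>" "x0 \<in> \<Omega>" "x1 \<in> open_segment x0 p"
    "y \<in> hilbert_cball \<Omega> x1 (hilbert_dist \<Omega> x1 x0)"
  shows "\<forall>\<^sub>F x in at p within open_segment x0 p. y \<in> hilbert_cball \<Omega> x (hilbert_dist \<Omega> x x0)"
proof -
  have par: "\<exists>t. 0 < t \<and> t < 1 \<and> x = p + t *\<^sub>R (x0 - p)" if x: "x \<in> open_segment x0 p" for x
  proof -
    obtain u where "0 < u" "u < 1" "x = (1 - u) *\<^sub>R x0 + u *\<^sub>R p" using x unfolding in_segment by blast
    then show ?thesis by (intro exI[of _ "1 - u"]) (auto simp: algebra_simps)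
  qed
  obtain t where t: "0 < t" "t < 1" "x1 = p + t *\<^sub>R (x0 - p)" using par[OF assms(3)] by blast
  have n: "norm (x0 - p) > 0" using frontier_notin assms by auto
  have "y \<in> hilbert_cball \<Omega> x (hilbert_dist \<Omega> x x0)"
    if "x \<in> open_segment x0 p" "dist x p < t * norm (x0 - p)" for x
  proof -
    obtain s where s: "0 < s" "s < 1" "x = p + s *\<^sub>R (x0 - p)" using par[OF \<open>x \<in> _\<close>] by blast
    then have "s * norm (x0 - p) < t * norm (x0 - p)" using that by (simp add: dist_norm)
    then have "s \<le> t" using n by simp
    then show ?thesis using hilbert_cball_mono[OF assms(1,2) s(1) _ t(2,3) s(3)] assms(4) by blast
  qed
  then show ?thesis
    unfolding eventually_at using t(1) n by (intro exI[of _ "t * norm (x0 - p)"]) auto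
qed

end

text \<open>By compactness, \<open>H\<close> lies within \<open>e\<close> of finitely many points of
  \<open>B\<close>, and finitely many points are eventually in \<open>A x\<close> simultaneously.
  The other half of the Hausdorff condition is immediate from
  \<open>A x \<subseteq> H\<close>.\<close>

lemma hausdorff_tendsto_closure_union:
  assumes "compact H" "H \<subseteq> closure B" "\<And>y. y \<in> B \<Longrightarrow> \<forall>\<^sub>F x in F. y \<in> A x" "\<forall>\<^sub>F x in F. A x \<subseteq> H"
  shows "hausdorff_tendsto A H F"
  unfolding hausdorff_tendsto_def
proof (intro allI impI)
  fix e :: real assume e: "e > 0"
  have "H \<subseteq> (\<Union>b\<in>B. ball b e)"
    using assms(2) e by (force simp: closure_approachable)
  then obtain T where T: "T \<subseteq> B" "finite T" "H \<subseteq> (\<Union>b\<in>T. ball b e)"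
    using compactE_image[OF assms(1), of B "\<lambda>b. ball b e"] by (metis open_ball)
  have "\<forall>\<^sub>F x in F. \<forall>y\<in>T. y \<in> A x" using T assms(3) by (intro eventually_ball_finite) auto
  with assms(4) show "\<forall>\<^sub>F x in F. A x \<subseteq> (\<Union>h\<in>H. ball h e) \<and> H \<subseteq> (\<Union>a\<in>A x. ball a e)"
  proof eventually_elim
    case (elim x)
    then show ?case using T(3) e by (auto simp: subset_iff) (meson centre_in_ball, blast)
  qed
qed


section \<open>Affine charts are open embeddings\<close>

lemma Rep_proj_of: "v \<noteq> 0 \<Longrightarrow> Rep_proj (proj_of v) = span {v}"
  unfolding proj_of_def by (rule Abs_proj_inverse) blast

lemma unit_reps_proj_of:
  assumes "v \<noteq> 0"
  shows "unit_reps (proj_of v) = {v /\<^sub>R norm v, - (v /\<^sub>R norm v)}"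
proof -
  obtain u where u: "unit_reps (proj_of v) = {u, -u}" by (rule unit_reps_eq)
  have "v /\<^sub>R norm v \<in> unit_reps (proj_of v)"
    using assms by (simp add: unit_reps_def Rep_proj_of span_base span_scale)
  then have "v /\<^sub>R norm v = u \<or> v /\<^sub>R norm v = -u" unfolding u by blast
  then show ?thesis unfolding u by auto
qed

lemma dist_proj_of_le:
  assumes "u \<noteq> 0" "v \<noteq> 0"
  shows "dist (proj_of u) (proj_of v) \<le> dist (u /\<^sub>R norm u) (v /\<^sub>R norm v)"
  unfolding dist_proj_def unit_reps_proj_of[OF assms(1)] unit_reps_proj_of[OF assms(2)]
  by (rule setdist_le_dist) auto

lemma affine_paramE:
  fixes \<phi> :: "real^'n::finite \<Rightarrow> 'n proj"
  assumes "affine_param \<phi>"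
  obtains g :: "(real^'n) \<times> real \<Rightarrow> (real^'n) \<times> real"
    where "linear g" "bij g" "\<And>x. \<phi> x = proj_of (g (x, 1))" "\<And>x. g (x, 1) \<noteq> 0"
proof -
  obtain g :: "(real^'n) \<times> real \<Rightarrow> (real^'n) \<times> real"
    where g: "linear g" "bij g" "\<phi> = (\<lambda>x. proj_of (g (x, 1)))"
    using assms unfolding affine_param_def by blast
  moreover have "g (x, 1) \<noteq> 0" for x
  proof -
    have "(x, 1 :: real) \<noteq> 0" by (simp add: zero_prod_def)
    then show ?thesis using linear_injective_0[OF g(1)] g(2) unfolding bij_def by blast
  qed
  ultimately show ?thesis using that by metis
qed

lemma affine_param_continuous:
  fixes \<phi> :: "real^'n::finite \<Rightarrow> 'n proj"
  assumes "affine_param \<phi>"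
  shows "continuous_on UNIV \<phi>"
proof -
  obtain g :: "(real^'n) \<times> real \<Rightarrow> (real^'n) \<times> real"
    where g: "linear g" "bij g" "\<And>x. \<phi> x = proj_of (g (x, 1))" and nz: "\<And>x. g (x, 1) \<noteq> 0"
    by (rule affine_paramE[OF assms(1)]) (rule that)
  \<comment> \<open>A continuous choice of unit representatives. The projective distance is a
    minimum over signs, hence at most the distance between the chosen ones.\<close>
  define G where "G = (\<lambda>x. g (x, 1) /\<^sub>R norm (g (x, 1)))"
  have "continuous_on UNIV (\<lambda>x. g (x, 1))"
    by (rule linear_continuous_on_compose[OF _ g(1)]) (intro continuous_intros)
  then have "continuous_on UNIV G"
    unfolding G_def by (intro continuous_intros) (auto simp: nz)
  then have "(G \<longlongrightarrow> G x) (at x)" for x by (simp add: continuous_on_def)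
  then have "((\<lambda>y. dist (G y) (G x)) \<longlongrightarrow> 0) (at x)" for x by (rule iffD1[OF tendsto_dist_iff])
  then have "((\<lambda>y. dist (\<phi> y) (\<phi> x)) \<longlongrightarrow> 0) (at x)" for x
    by (rule Lim_null_comparison[rotated])
      (simp add: g(3) G_def dist_proj_of_le nz)
  then have "(\<phi> \<longlongrightarrow> \<phi> x) (at x)" for x by (rule iffD2[OF tendsto_dist_iff])
  then show ?thesis by (simp add: continuous_on_def)
qed

text \<open>Dehomogenising inverts the chart: a projective point close to \<open>\<phi> x\<close>
  has a unit representative close to that of \<open>\<phi> x\<close>, and dividing by its last
  coordinate after \<open>h\<close> gives a preimage in \<open>U\<close>.\<close>

lemma affine_param_open_image:
  fixes \<phi> :: "real^'n::finite \<Rightarrow> 'n proj"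
  assumes "affine_param \<phi>" "open U"
  shows "open (\<phi> ` U)"
proof -
  obtain g :: "(real^'n) \<times> real \<Rightarrow> (real^'n) \<times> real"
    where g: "linear g" "bij g" "\<And>x. \<phi> x = proj_of (g (x, 1))" and nz: "\<And>x. g (x, 1) \<noteq> 0"
    by (rule affine_paramE[OF assms(1)]) (rule that)
  obtain h where h: "linear h" "g \<circ> h = id"
    using linear_surjective_right_inverse[OF g(1)] g(2) by (auto simp: bij_def)
  have hg: "h (g z) = z" for z
  proof -
    have "g (h (g z)) = g z" using h(2) by (metis comp_apply id_apply)
    then show ?thesis using g(2) by (metis bij_def injD)
  qed
  have ch: "continuous_on A h" for A using h(1) by (simp add: linear_continuous_on linear_conv_bounded_linear)
  \<comment> \<open>\<open>h\<close> undoes \<open>g\<close>, so on the half-space \<open>W\<close>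
    the map \<open>r\<close> sends a positive multiple of \<open>g (x, 1)\<close> to
    \<open>x\<close>.\<close>
  define W where "W = {w. snd (h w) > 0}"
  define r where "r = (\<lambda>w. fst (h w) /\<^sub>R snd (h w))"
  have oW: "open W" unfolding W_def
    by (intro open_Collect_less continuous_intros ch)
  have "continuous_on W r" unfolding r_def
    by (intro continuous_intros ch) (auto simp: W_def)
  then have oV: "open (W \<inter> r -` U)" using oW assms(2) by (simp add: continuous_on_open_vimage Int_commute)
  have "\<exists>e>0. ball (\<phi> x) e \<subseteq> \<phi> ` U" if "x \<in> U" for x
  proof -
    define u where "u = g (x, 1) /\<^sub>R norm (g (x, 1))"
    have "h u = (x, 1) /\<^sub>R norm (g (x, 1))" unfolding u_def by (simp add: linear_scale[OF h(1)] hg)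
    then have "u \<in> W \<inter> r -` U" using that nz[of x] by (simp add: W_def r_def)
    then obtain e where e: "e > 0" "ball u e \<subseteq> W \<inter> r -` U" using oV by (meson openE)
    have "Q \<in> \<phi> ` U" if Q: "dist (\<phi> x) Q < e" for Q
    proof -
      have "unit_reps (\<phi> x) = {u, -u}" unfolding g(3) u_def by (rule unit_reps_proj_of[OF nz])
      moreover obtain w where w: "norm w = 1" "unit_reps Q = {w, -w}" "Rep_proj Q = span {w}"
        by (rule unit_reps_eq)
      ultimately have "setdist {u, -u} {w, -w} < e" using Q by (simp add: dist_proj_def)
      then obtain a b where ab: "a \<in> {u, -u}" "b \<in> {w, -w}" "dist a b < e"
        using setdist_ltE[of "{u, -u}" "{w, -w}" e] by blast
      \<comment> \<open>The nearby pair may consist of \<open>a = -u\<close> and \<open>b\<close>;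
        changing both signs makes it a pair starting at \<open>u\<close>.\<close>
      define v where "v = (if a = u then b else - b)"
      have "dist u v < e" using ab(1,3) by (auto simp: v_def dist_norm norm_minus_commute add.commute)
      then have v: "v \<in> W" "r v \<in> U" using e(2) by auto
      have "v \<in> {w, -w}" using ab(2) by (auto simp: v_def)
      then have "span {v} = span {w}"
      proof -
        have "span {- w} = span {w}"
          using span_singleton[of w] span_singleton[of "- w"]
          by (metis (no_types, lifting) antisym insert_subset empty_subsetI minus_minus span_base span_minimal span_neg subspace_span singletonI)
        then show ?thesis using \<open>v \<in> {w, -w}\<close> by auto
      qed
      moreover have "span {g (r v, 1)} = span {v}"
      proof -
        define s where "s = snd (h v)"
        have s: "s > 0" using v(1) by (simp add: s_def W_def)
        have "h v = s *\<^sub>R (r v, 1)" using s by (simp add: r_def s_def prod_eq_iff)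
        then have v_eq: "v = s *\<^sub>R g (r v, 1)" using h(2) linear_scale[OF g(1)] by (metis comp_apply id_apply)
        have "b = (1 / s) *\<^sub>R a" if "a = s *\<^sub>R b" for a b :: "(real^'n) \<times> real" using that s by simp
        from this[OF v_eq] have y: "g (r v, 1) = (1 / s) *\<^sub>R v" .
        have "s *\<^sub>R g (r v, 1) \<in> span {g (r v, 1)}" by (intro span_scale span_base) simp
        then have "v \<in> span {g (r v, 1)}" using v_eq by metis
        moreover have "g (r v, 1) \<in> span {v}" unfolding y by (intro span_scale span_base) simp
        ultimately show ?thesis by (intro antisym span_minimal) auto
      qed
      ultimately have "Rep_proj (\<phi> (r v)) = Rep_proj Q"
        unfolding g(3) Rep_proj_of[OF nz] w(3) by simp
      then show ?thesis using v(2) by (metis Rep_proj_inject imageI)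
    qed
    then show ?thesis using e(1) by (intro exI[of _ e]) auto
  qed
  then show ?thesis unfolding open_contains_ball by blast
qed

section \<open>Horoballs in projective space and comparison of the infima\<close>

lemma lambda1_on_antimono: "U \<subseteq> V \<Longrightarrow> lambda1_on \<Omega> V \<le> lambda1_on \<Omega> U"
  unfolding lambda1_on_def test_function_def by (rule INF_superset_mono) (blast, simp)

text \<open>A Hausdorff limit of subsets of \<open>C\<close> lies in \<open>closure C\<close>, and
  an open convex set is the interior of its closure. The latter is applied in the chart, where
  \<open>\<phi>\<close> is continuous and open.\<close>

lemma horoball_interior_subset:
  assumes "bounded_convex_chart \<phi> C" "horoball \<phi> C H"
  shows "\<phi> -` interior H \<subseteq> \<phi> -` C"
proof -
  define \<Omega> where "\<Omega> = \<phi> -` C"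
  interpret bounded_open_convex \<Omega>
    using assms(1) by unfold_locales (auto simp: \<Omega>_def bounded_convex_chart_def)
  have ap: "affine_param \<phi>" using assms(1) by (simp add: bounded_convex_chart_def)
  obtain x0 p where h: "x0 \<in> \<Omega>" "p \<in> frontier \<Omega>"
    "hausdorff_tendsto (\<lambda>x. \<phi> ` hilbert_cball \<Omega> x (hilbert_dist \<Omega> x x0)) H (at p within open_segment x0 p)"
    using assms(2) by (auto simp: horoball_def \<Omega>_def)
  \<comment> \<open>The filter must be nontrivial for an eventual statement to yield an actual
    ball.\<close>
  have "x0 \<noteq> p" using h frontier_notin by auto
  then have "p \<in> closure (open_segment x0 p)" by simp
  then have "p islimpt open_segment x0 p" by (auto simp: closure_def open_segment_def)
  then have nt: "at p within open_segment x0 p \<noteq> bot" by (simp add: trivial_limit_within)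
  have "H \<subseteq> closure C"
  proof
    fix y assume y: "y \<in> H"
    have "\<exists>z\<in>C. dist z y < e" if "e > 0" for e
    proof -
      have "\<forall>\<^sub>F x in at p within open_segment x0 p. H \<subseteq> (\<Union>a\<in>\<phi> ` hilbert_cball \<Omega> x (hilbert_dist \<Omega> x x0). ball a e)"
        using h(3)[unfolded hausdorff_tendsto_def, rule_format, OF that] by (rule eventually_mono) blast
      then obtain x where "H \<subseteq> (\<Union>a\<in>\<phi> ` hilbert_cball \<Omega> x (hilbert_dist \<Omega> x x0). ball a e)"
        using nt eventually_happens' by blast
      then show ?thesis using y by (fastforce simp: hilbert_cball_def \<Omega>_def)
    qed
    then show "y \<in> closure C" by (simp add: closure_approachable)
  qed
  have "\<phi> -` interior H \<subseteq> closure \<Omega>"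
  proof
    fix x assume x: "x \<in> \<phi> -` interior H"
    show "x \<in> closure \<Omega>"
    proof (rule ccontr)
      assume "x \<notin> closure \<Omega>"
      then have "\<phi> x \<in> \<phi> ` (- closure \<Omega>)" by simp
      moreover have "\<phi> x \<in> closure C" using x interior_subset \<open>H \<subseteq> closure C\<close> by blast
      moreover have "open (\<phi> ` (- closure \<Omega>))" by (rule affine_param_open_image[OF ap]) (simp add: open_Compl)
      ultimately have "\<phi> ` (- closure \<Omega>) \<inter> C \<noteq> {}"
        by (metis (no_types, lifting) IntI empty_iff open_Int_closure_eq_empty)
      then show False using closure_subset[of \<Omega>] unfolding \<Omega>_def by blast
    qed
  qed
  moreover have "open (\<phi> -` interior H)"
    using affine_param_continuous[OF ap] by (simp add: open_vimage)
  ultimately have "\<phi> -` interior H \<subseteq> interior (closure \<Omega>)" by (simp add: interior_maximal)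
  then show ?thesis using convex_interior_closure[OF cvx] op by (simp add: interior_open \<Omega>_def)
qed

lemma horoball_containing_compact:
  assumes "bounded_convex_chart \<phi> C" "compact S" "S \<subseteq> \<phi> -` C" "S \<noteq> {}"
  obtains H where "horoball \<phi> C H" "S \<subseteq> \<phi> -` interior H"
proof -
  define \<Omega> where "\<Omega> = \<phi> -` C"
  interpret bounded_open_convex \<Omega>
    using assms(1) by unfold_locales (auto simp: \<Omega>_def bounded_convex_chart_def)
  have ap: "affine_param \<phi>" using assms(1) by (simp add: bounded_convex_chart_def)
  note cont = affine_param_continuous[OF ap]
  obtain e where e: "e > 0" "(\<Union>y\<in>S. cball y e) \<subseteq> \<Omega>"
    using compact_subset_open_imp_cball_epsilon_subset[OF assms(2) op] assms(3) by (auto simp: \<Omega>_def)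
  \<comment> \<open>Half of the margin \<open>e\<close> thickens \<open>S\<close> to an open
    neighbourhood, and the other half remains as depth of its points. The horoball thus contains
    \<open>S\<close> in its interior.\<close>
  define d where "d = e / 2"
  have d: "d > 0" using e by (simp add: d_def)
  have deep: "cball y d \<subseteq> \<Omega>" if "z \<in> S" "y \<in> cball z d" for y z
  proof -
    have "cball y d \<subseteq> cball z e"
      using that(2) unfolding d_def by (auto simp: dist_commute) (smt (verit) dist_commute dist_triangle field_sum_of_halves)
    then show ?thesis using e(2) that(1) by blast
  qed
  obtain c where c: "c \<in> S" using assms(4) by blast
  then have cO: "c \<in> \<Omega>" using assms(3) by (auto simp: \<Omega>_def)
  \<comment> \<open>Any frontier point can be the centre of the horoball; an arbitrary direction
    from \<open>c\<close> supplies one.\<close>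
  obtain p where p: "p \<in> frontier \<Omega>"
    using exit_exists[OF cO, of "axis undefined 1"] by (metis axis_eq_0_iff zero_neq_one)
  have "cball c d \<subseteq> \<Omega>" using deep c d by auto
  then obtain x0 x where x0: "x0 \<in> \<Omega>" "x \<in> open_segment x0 p"
    "\<And>y. cball y d \<subseteq> \<Omega> \<Longrightarrow> y \<in> hilbert_cball \<Omega> x (hilbert_dist \<Omega> x x0)"
    using deep_points_in_ball[OF p cO _ d] by blast
  define A where "A = (\<lambda>x. hilbert_cball \<Omega> x (hilbert_dist \<Omega> x x0))"
  define B where "B = (\<Union>x\<in>open_segment x0 p. A x)"
  define H where "H = \<phi> ` closure B"
  have "B \<subseteq> \<Omega>" by (auto simp: B_def A_def hilbert_cball_def)
  then have "compact (closure B)" using bounded bounded_subset compact_closure by blast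
  then have cH: "compact H" unfolding H_def
    using cont by (meson compact_continuous_image continuous_on_subset subset_UNIV)
  have "hausdorff_tendsto (\<lambda>x. \<phi> ` A x) H (at p within open_segment x0 p)"
  proof (rule hausdorff_tendsto_closure_union[OF cH])
    show "H \<subseteq> closure (\<phi> ` B)" unfolding H_def
      by (rule image_closure_subset[OF continuous_on_subset[OF cont]]) (simp_all add: closure_subset)
    show "\<forall>\<^sub>F x in at p within open_segment x0 p. \<phi> ` A x \<subseteq> H"
      unfolding eventually_at_filter using closure_subset[of B]
      by (intro always_eventually) (auto simp: H_def B_def)
    fix y assume "y \<in> \<phi> ` B"
    then obtain z x1 where z: "y = \<phi> z" "x1 \<in> open_segment x0 p" "z \<in> A x1" by (auto simp: B_def)
    have "\<forall>\<^sub>F x in at p within open_segment x0 p. z \<in> A x"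
      using eventually_mem_hilbert_cball[OF p x0(1) z(2)] z(3) by (simp add: A_def)
    then show "\<forall>\<^sub>F x in at p within open_segment x0 p. y \<in> \<phi> ` A x"
      by (rule eventually_mono) (simp add: z(1))
  qed
  then have "horoball \<phi> C H"
    unfolding horoball_def using compact_imp_closed[OF cH] x0(1) p by (auto simp: \<Omega>_def A_def)
  moreover have "S \<subseteq> \<phi> -` interior H"
  proof -
    define U where "U = (\<Union>z\<in>S. ball z d)"
    have "U \<subseteq> A x" using deep x0(3) by (auto simp: U_def A_def)
    then have "\<phi> ` U \<subseteq> H" using x0(2) closure_subset[of B] by (auto simp: H_def B_def)
    moreover have "open (\<phi> ` U)" by (intro affine_param_open_image[OF ap]) (auto simp: U_def)
    ultimately have "\<phi> ` U \<subseteq> interior H" by (rule interior_maximal)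
    moreover have "S \<subseteq> U" using d by (auto simp: U_def)
    ultimately show ?thesis by blast
  qed
  ultimately show ?thesis using that by blast
qed

theorem proposition7:
  fixes C :: "'n::finite proj set" and \<phi> :: "real^'n \<Rightarrow> 'n proj"
  assumes "properly_open_convex C"
    and "bounded_convex_chart \<phi> C"
  shows "lambda1 \<phi> C = (INF H\<in>{H. horoball \<phi> C H}. lambda1_horoball \<phi> C H)"
proof (rule antisym)
  show "lambda1 \<phi> C \<le> (INF H\<in>{H. horoball \<phi> C H}. lambda1_horoball \<phi> C H)"
    unfolding lambda1_def lambda1_horoball_def
    using lambda1_on_antimono horoball_interior_subset[OF assms(2)] by (intro INF_greatest) auto
  show "(INF H\<in>{H. horoball \<phi> C H}. lambda1_horoball \<phi> C H) \<le> lambda1 \<phi> C"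
    unfolding lambda1_def lambda1_on_def
  proof (rule INF_greatest)
    fix f assume "f \<in> {f. test_function (\<phi> -` C) (\<phi> -` C) f}"
    then have f: "test_function (\<phi> -` C) (\<phi> -` C) f" by simp
    define S where "S = closure {x. f x \<noteq> 0}"
    have "compact S" "S \<subseteq> \<phi> -` C" "S \<noteq> {}" using f by (auto simp: S_def test_function_def)
    then obtain H where H: "horoball \<phi> C H" "S \<subseteq> \<phi> -` interior H"
      using horoball_containing_compact[OF assms(2)] by blast
    \<comment> \<open>The set \<open>U\<close> enters \<open>test_function\<close> only through the
      support condition, and \<open>rayleigh\<close> is computed in \<open>C\<close> for both
      infima, so \<open>f\<close> keeps its quotient.\<close>
    have "test_function (\<phi> -` C) (\<phi> -` interior H) f"
      using f H(2) by (simp add: test_function_def S_def)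
    then have "lambda1_horoball \<phi> C H \<le> rayleigh (\<phi> -` C) f"
      unfolding lambda1_horoball_def lambda1_on_def by (intro INF_lower) simp
    then show "(INF H\<in>{H. horoball \<phi> C H}. lambda1_horoball \<phi> C H) \<le> rayleigh (\<phi> -` C) f"
      using H(1) by (intro INF_lower2[of H]) auto
  qed
qed

end
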